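(* Let $\mathbb F$ be a field, $n\ge 1$, and let $p=p_n$ and $q=p_{n-1}$ be monic polynomials over $\mathbb F$ of degree $n$ and $n-1$ respectively, having no common root. Suppose one of the following holds, and define a linear functional $\mathscr L:\mathbb F[t]\to\mathbb F$ accordingly: (i) all the roots $\lambda_1,\dots,\lambda_n$ of $p$ are different, so $p_n(t)=\prod_{k=1}^n(t-\lambda_k)$, and $\mathscr L=\mathscr L_1$ with $$\mathscr L_1(f)=\sum_{k=1}^n\frac{f(\lambda_k)}{p_n'(\lambda_k)\,p_{n-1}(\lambda_k)};$$ (ii) all the roots of $p$ are the same, namely $p_n(t)=(t-a)^n$, and $\mathscr L=\mathscr L_2$ with $$\mathscr L_2(f)=C\,[(z-a)^{n-1}]\left(\frac{f(z)}{p_{n-1}(z)}\right),$$ where $C\in\mathbb F$ is a nonzero constant and $[(z-a)^{n-1}]$ denotes the coefficient of $(z-a)^{n-1}$ in the power series expansion around $a$. Then the following statements are equivalent: 1. $p$ and $q$ form a proper pair. 2. All the Hankel matrices $H_k$ associated with $\mathscr L$ are invertible for $k=0,1,\dots,n-1$.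
   Context: Roots are taken in an algebraic closure of $\mathbb F$. For a linear functional $\mathscr L$ on $\mathbb F[t]$, its moments are $m_j=\mathscr L(t^j)$, $j\ge 0$, and its Hankel matrix $H_k$ is the $(k+1)\times(k+1)$ matrix $H_k=(m_{i+j})_{0\le i,j\le k}$. Monic polynomials $p,q$ over $\mathbb F$ of degrees $n,n-1$ form a proper pair if, when the (Euclidean) division algorithm is applied to $p$ and $q$, the degree of the remainder drops by exactly $1$ each time: setting $r_{-1}=p$, $r_0=q$ and letting $r_{i+1}$ be the remainder of the division of $r_{i-1}$ by $r_i$, one has $\deg r_i=n-1-i$ for all $i=0,1,\dots,n-1$ (so $r_{n-1}$ is a nonzero constant). When $(n-1)!$ is nonzero in $\mathbb F$, $[(z-a)^{n-1}]g(z)=\frac{1}{(n-1)!}g^{(n-1)}(a)$, so $\mathscr L_2(f)$ is then a nonzero constant times $\frac{d^{n-1}}{dz^{n-1}}\left(\frac{f(z)}{p_{n-1}(z)}\right)(a)$. *)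

theory Defs
  imports "HOL-Algebra.Algebraic_Closure_Type" "Jordan_Normal_Form.Matrix"
begin

text \<open>
  The library type \<open>'a alg_closure\<close> serves as the algebraic closure of the field \<open>'a\<close>, with
  embedding \<open>to_ac\<close> and partial inverse \<open>of_ac\<close> (which is 0 outside the range of \<open>to_ac\<close>).
\<close>

abbreviation poly_ac :: "'a::field poly \<Rightarrow> 'a alg_closure poly" where
  "poly_ac \<equiv> map_poly to_ac"

definition no_common_root :: "'a::field poly \<Rightarrow> 'a poly \<Rightarrow> bool" where
  "no_common_root p q \<longleftrightarrow> \<not> (\<exists>x. poly (poly_ac p) x = 0 \<and> poly (poly_ac q) x = 0)"

text \<open>The index is shifted by one: \<open>rem_seq p q (i + 1)\<close> is the remainder $r_i$.\<close>

fun rem_seq :: "'a::field poly \<Rightarrow> 'a poly \<Rightarrow> nat \<Rightarrow> 'a poly" where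
  "rem_seq p q 0 = p"
| "rem_seq p q (Suc 0) = q"
| "rem_seq p q (Suc (Suc j)) = rem_seq p q j mod rem_seq p q (Suc j)"

text \<open>
  The condition that the remainders are nonzero is needed because the zero polynomial has
  \<open>degree\<close> 0 in the library.
\<close>

definition proper_pair :: "nat \<Rightarrow> 'a::field poly \<Rightarrow> 'a poly \<Rightarrow> bool" where
  "proper_pair n p q \<longleftrightarrow>
     Polynomial.lead_coeff p = 1 \<and> Polynomial.degree p = n \<and>
     Polynomial.lead_coeff q = 1 \<and> Polynomial.degree q = n - 1 \<and>
     (\<forall>i<n. rem_seq p q (i + 1) \<noteq> 0 \<and> Polynomial.degree (rem_seq p q (i + 1)) = n - 1 - i)"

definition moment :: "('a::field poly \<Rightarrow> 'a) \<Rightarrow> nat \<Rightarrow> 'a" where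
  "moment L j = L (Polynomial.monom 1 j)"

definition hankel :: "('a::field poly \<Rightarrow> 'a) \<Rightarrow> nat \<Rightarrow> 'a mat" where
  "hankel L k = mat (k + 1) (k + 1) (\<lambda>(i, j). moment L (i + j))"

text \<open>
  The values of the following two functionals are given by expressions over the algebraic closure.
  Lemmas \<open>to_ac_L1\<close> and \<open>to_ac_L2\<close> below show that these expressions lie in the ground field, so
  that \<open>of_ac\<close> is never applied outside its proper domain.
\<close>

definition L1_ac ::
  "nat \<Rightarrow> (nat \<Rightarrow> 'a::field alg_closure) \<Rightarrow> 'a poly \<Rightarrow> 'a poly \<Rightarrow> 'a poly \<Rightarrow> 'a alg_closure" where
  "L1_ac n lam p q f =
     (\<Sum>k=1..n. poly (poly_ac f) (lam k) /
        (poly (pderiv (poly_ac p)) (lam k) * poly (poly_ac q) (lam k)))"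

definition L1 :: "nat \<Rightarrow> (nat \<Rightarrow> 'a::field alg_closure) \<Rightarrow> 'a poly \<Rightarrow> 'a poly \<Rightarrow> 'a poly \<Rightarrow> 'a" where
  "L1 n lam p q f = of_ac (L1_ac n lam p q f)"

text \<open>The expansion of a polynomial around \<open>a\<close>, as a power series in $z - a$.\<close>

definition expand_at :: "'a::field alg_closure \<Rightarrow> 'a poly \<Rightarrow> 'a alg_closure fps" where
  "expand_at a f = fps_of_poly (pcompose (poly_ac f) [:a, 1:])"

definition L2_ac ::
  "nat \<Rightarrow> 'a::field alg_closure \<Rightarrow> 'a \<Rightarrow> 'a poly \<Rightarrow> 'a poly \<Rightarrow> 'a alg_closure" where
  "L2_ac n a C q f = to_ac C * fps_nth (expand_at a f / expand_at a q) (n - 1)"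

definition L2 :: "nat \<Rightarrow> 'a::field alg_closure \<Rightarrow> 'a \<Rightarrow> 'a poly \<Rightarrow> 'a poly \<Rightarrow> 'a" where
  "L2 n a C q f = of_ac (L2_ac n a C q f)"


lemma poly_ac_0: "poly_ac 0 = 0"
  by simp

lemma poly_ac_1: "poly_ac 1 = 1"
  by (simp add: map_poly_1')

lemma poly_ac_add: "poly_ac (f + g) = poly_ac f + poly_ac g"
  by (rule poly_eqI) (simp add: coeff_map_poly)

lemma poly_ac_smult: "poly_ac (Polynomial.smult c f) = Polynomial.smult (to_ac c) (poly_ac f)"
  by (rule poly_eqI) (simp add: coeff_map_poly)

lemma poly_ac_mult: "poly_ac (f * g) = poly_ac f * poly_ac g"
  by (rule poly_eqI) (simp add: coeff_map_poly coeff_mult to_ac_sum)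

lemma degree_poly_ac: "Polynomial.degree (poly_ac f) = Polynomial.degree f"
  by (rule degree_map_poly) simp

lemma no_common_root_bezout:
  fixes p q :: "'a::field poly"
  assumes "p \<noteq> 0" "no_common_root p q"
  obtains u v where "u * p + v * q = 1"
proof -
  define I where "I d \<longleftrightarrow> d \<noteq> 0 \<and> (\<exists>u v. d = u * p + v * q)" for d
  have "p = 1 * p + 0 * q" by simp
  then have "I p" using assms(1) unfolding I_def by blast
  then obtain d where d: "I d" and min: "\<And>e. I e \<Longrightarrow> Polynomial.degree d \<le> Polynomial.degree e"
    using ex_has_least_nat[of I p Polynomial.degree] by blast
  from d obtain u v where uv: "d = u * p + v * q" and d0: "d \<noteq> 0" unfolding I_def by blast
  have dvd: "d dvd e" if e: "e = x * p + y * q" for e x y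
  proof (rule ccontr)
    assume "\<not> d dvd e"
    then have ne: "e mod d \<noteq> 0" by (simp add: mod_eq_0_iff_dvd)
    have "e mod d = e - (e div d) * d" by (simp add: minus_div_mult_eq_mod)
    also have "\<dots> = (x - (e div d) * u) * p + (y - (e div d) * v) * q"
      unfolding e by (subst (2) uv) (simp add: algebra_simps)
    finally have "I (e mod d)" using ne unfolding I_def by blast
    from min[OF this] degree_mod_less[OF d0, of e] ne show False by simp
  qed
  have "d dvd p" "d dvd q" using dvd[of p 1 0] dvd[of q 0 1] by simp_all
  then obtain r s where rs: "p = d * r" "q = d * s" by (auto simp: dvd_def)
  have "Polynomial.degree d = 0"
  proof (rule ccontr)
    assume "Polynomial.degree d \<noteq> 0"
    then obtain x where "poly (poly_ac d) x = 0"
      using alg_closed_imp_poly_has_root[of "poly_ac d"] by (auto simp: degree_poly_ac)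
    then have "poly (poly_ac p) x = 0 \<and> poly (poly_ac q) x = 0"
      unfolding rs by (simp add: poly_ac_mult)
    then show False using assms(2) unfolding no_common_root_def by blast
  qed
  then obtain c where c: "d = [:c:]" by (rule degree_eq_zeroE)
  with d0 have "c \<noteq> 0" by auto
  have "Polynomial.smult (inverse c) u * p + Polynomial.smult (inverse c) v * q
      = Polynomial.smult (inverse c) d"
    unfolding uv by (simp add: smult_add_right)
  also have "\<dots> = 1" using \<open>c \<noteq> 0\<close> by (simp add: c)
  finally show thesis by (rule that)
qed

text \<open>
  If \<open>v\<close> is an inverse of \<open>q\<close> modulo \<open>p\<close>, both functionals take \<open>f\<close> to the coefficient of
  $t^{n-1}$ in the remainder of $f v$ modulo \<open>p\<close>, up to the constant factor \<open>C\<close> for \<open>L2\<close>.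
\<close>

lemma lagrange_coeff:
  fixes lam :: "nat \<Rightarrow> 'b::field"
  assumes inj: "inj_on lam {1..n}" and "n \<ge> 1" and deg: "Polynomial.degree h < n"
    and P: "P = (\<Prod>k=1..n. [:- lam k, 1:])"
  shows "(\<Sum>k=1..n. poly h (lam k) / poly (pderiv P) (lam k)) = Polynomial.coeff h (n - 1)"
proof -
  define M where "M k = (\<Prod>j\<in>{1..n}-{k}. [:- lam j, 1:])" for k
  define R where "R = (\<Sum>k=1..n. Polynomial.smult (poly h (lam k) / poly (pderiv P) (lam k)) (M k))"
  have M0: "poly (M k) (lam i) = 0" if "i \<in> {1..n}" "i \<noteq> k" for i k
    using that by (force simp: M_def poly_prod)
  have Mk: "poly (M k) (lam k) \<noteq> 0" if "k \<in> {1..n}" for k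
  proof -
    have "lam j \<noteq> lam k" if "j \<in> {1..n} - {k}" for j
      using inj_onD[OF inj, of j k] that \<open>k \<in> {1..n}\<close> by blast
    then show ?thesis by (force simp: M_def poly_prod)
  qed
  have "pderiv P = (\<Sum>k=1..n. M k)"
    unfolding P M_def by (simp add: pderiv_prod pderiv_pCons)
  then have dP: "poly (pderiv P) (lam i) = poly (M i) (lam i)" if "i \<in> {1..n}" for i
  proof -
    have "poly (pderiv P) (lam i) = (\<Sum>k\<in>{1..n}. poly (M k) (lam i))"
      using \<open>pderiv P = _\<close> by (simp add: poly_sum)
    also have "\<dots> = poly (M i) (lam i) + (\<Sum>k\<in>{1..n}-{i}. poly (M k) (lam i))"
      by (rule sum.remove) (use that in auto)
    also have "(\<Sum>k\<in>{1..n}-{i}. poly (M k) (lam i)) = 0"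
      by (rule sum.neutral) (use M0[OF that] in auto)
    finally show ?thesis by simp
  qed
  have degM: "Polynomial.degree (M k) = n - 1" if "k \<in> {1..n}" for k
    unfolding M_def using that by (subst degree_prod_sum_eq) auto
  have lcM: "Polynomial.coeff (M k) (n - 1) = 1" if "k \<in> {1..n}" for k
  proof -
    have "Polynomial.lead_coeff (M k) = 1"
      unfolding M_def by (simp add: lead_coeff_prod)
    then show ?thesis using degM[OF that] by simp
  qed
  have "h = R"
  proof (rule poly_eqI_degree[where A = "lam ` {1..n}"])
    fix x assume "x \<in> lam ` {1..n}"
    then obtain i where i: "i \<in> {1..n}" "x = lam i" by blast
    have "poly R (lam i) = poly h (lam i) / poly (pderiv P) (lam i) * poly (M i) (lam i)"
    proof -
      define t where "t k = poly h (lam k) / poly (pderiv P) (lam k) * poly (M k) (lam i)" for k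
      have "poly R (lam i) = (\<Sum>k\<in>{1..n}. t k)"
        by (simp add: R_def t_def poly_sum)
      also have "\<dots> = t i + (\<Sum>k\<in>{1..n}-{i}. t k)"
        by (rule sum.remove) (use i(1) in auto)
      also have "(\<Sum>k\<in>{1..n}-{i}. t k) = 0"
        by (rule sum.neutral) (use M0[OF i(1)] in \<open>auto simp: t_def\<close>)
      finally show ?thesis by (simp add: t_def)
    qed
    also have "\<dots> = poly h (lam i)" using Mk[OF i(1)] by (simp add: dP[OF i(1)])
    finally show "poly h x = poly R x" using i by simp
  next
    show "Polynomial.degree h < card (lam ` {1..n})"
      using deg inj by (simp add: card_image)
    have "Polynomial.degree R \<le> n - 1"
      unfolding R_def
      by (intro degree_sum_le) (auto intro!: order.trans[OF degree_smult_le] simp: degM)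
    then show "Polynomial.degree R < card (lam ` {1..n})"
      using inj \<open>n \<ge> 1\<close> by (simp add: card_image)
  qed
  then have "Polynomial.coeff h (n - 1) = Polynomial.coeff R (n - 1)" by simp
  also have "\<dots> = (\<Sum>k=1..n. poly h (lam k) / poly (pderiv P) (lam k))"
    unfolding R_def coeff_sum by (intro sum.cong refl) (use lcM in auto)
  finally show ?thesis by simp
qed

lemma degree_mod_less_deg:
  fixes f p :: "'a::field poly"
  assumes "Polynomial.degree p = n" "n \<ge> 1"
  shows "Polynomial.degree (f mod p) < n"
proof -
  from assms have "p \<noteq> 0" by auto
  then show ?thesis using degree_mod_less[of p f] assms by (cases "f mod p = 0") auto
qed

lemma L1_ac_eq:
  fixes p q :: "'a::field poly"
  assumes n: "n \<ge> 1" "Polynomial.degree p = n"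
    and inj: "inj_on lam {1..n}" and P: "poly_ac p = (\<Prod>k=1..n. [:- lam k, 1:])"
    and uv: "u * p + v * q = 1"
  shows "L1_ac n lam p q f = to_ac (Polynomial.coeff ((f * v) mod p) (n - 1))"
proof -
  define h where "h = (f * v) mod p"
  have "f * v = (f * v) div p * p + h" by (simp add: h_def)
  then have h: "poly_ac f * poly_ac v = poly_ac ((f * v) div p) * poly_ac p + poly_ac h"
    by (simp flip: poly_ac_mult poly_ac_add)
  have UV: "poly_ac u * poly_ac p + poly_ac v * poly_ac q = 1"
    by (simp add: uv poly_ac_1 flip: poly_ac_mult poly_ac_add)
  have term_eq: "poly (poly_ac f) (lam k) / (poly (pderiv (poly_ac p)) (lam k) * poly (poly_ac q) (lam k))
      = poly (poly_ac h) (lam k) / poly (pderiv (poly_ac p)) (lam k)" if "k \<in> {1..n}" for k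
  proof -
    have p0: "poly (poly_ac p) (lam k) = 0"
      using that by (force simp: P poly_prod)
    have "poly (poly_ac v) (lam k) * poly (poly_ac q) (lam k) = 1"
      using arg_cong[OF UV, of "\<lambda>g. poly g (lam k)"] p0 by simp
    moreover have "poly (poly_ac f) (lam k) * poly (poly_ac v) (lam k) = poly (poly_ac h) (lam k)"
      using arg_cong[OF h, of "\<lambda>g. poly g (lam k)"] p0 by simp
    moreover have "F / (D * Q) = H / D" if "V * Q = 1" "F * V = H" for F D Q H V :: "'a alg_closure"
    proof -
      have "Q \<noteq> 0" using that(1) by auto
      then have "V = 1 / Q" using that(1) by (simp add: field_simps)
      then show ?thesis using that(2) by auto
    qed
    ultimately show ?thesis by blast
  qed
  have "Polynomial.degree (poly_ac h) < n"
    using degree_mod_less_deg[OF n(2,1)] by (simp add: h_def degree_poly_ac)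
  then have "(\<Sum>k=1..n. poly (poly_ac h) (lam k) / poly (pderiv (poly_ac p)) (lam k))
      = Polynomial.coeff (poly_ac h) (n - 1)"
    by (rule lagrange_coeff[OF inj n(1) _ P])
  then show ?thesis
    unfolding L1_ac_def by (simp add: term_eq coeff_map_poly h_def)
qed

lemma expand_at_1: "expand_at a 1 = 1"
  by (simp add: expand_at_def poly_ac_1 pcompose_1)

lemma expand_at_add: "expand_at a (f + g) = expand_at a f + expand_at a g"
  by (simp add: expand_at_def poly_ac_add pcompose_add fps_of_poly_add)

lemma expand_at_mult: "expand_at a (f * g) = expand_at a f * expand_at a g"
  by (simp add: expand_at_def poly_ac_mult pcompose_mult fps_of_poly_mult)

lemma L2_ac_eq:
  fixes p q :: "'a::field poly"
  assumes n: "n \<ge> 1" "Polynomial.degree p = n"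
    and P: "poly_ac p = [:- a, 1:] ^ n"
    and uv: "u * p + v * q = 1"
  shows "L2_ac n a C q f = to_ac (C * Polynomial.coeff ((f * v) mod p) (n - 1))"
proof -
  define h where "h = (f * v) mod p"
  define E where "E = expand_at a"
  have Ep: "E p = fps_X ^ n"
  proof -
    have "pcompose ([:- a, 1:] ^ n) [:a, 1:] = [:0, 1:] ^ n"
      by (induction n) (simp_all add: pcompose_1 pcompose_mult pcompose_pCons del: mult_pCons_left)
    then show ?thesis by (simp add: E_def expand_at_def P fps_of_poly_power)
  qed
  have "f * v = (f * v) div p * p + h" by (simp add: h_def)
  then have h: "E f * E v = E ((f * v) div p) * fps_X ^ n + E h"
    unfolding Ep[symmetric] E_def expand_at_mult[symmetric] expand_at_add[symmetric] by simp
  have UV: "E u * fps_X ^ n + E v * E q = 1"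
    unfolding Ep[symmetric] E_def expand_at_mult[symmetric] expand_at_add[symmetric]
    by (simp add: uv expand_at_1)
  have "fps_nth (E v) 0 * fps_nth (E q) 0 = 1"
    using arg_cong[OF UV, of "\<lambda>g. fps_nth g 0"] n(1) by simp
  then have q0: "fps_nth (E q) 0 \<noteq> 0" by auto
  define Y where "Y = inverse (E q)"
  have Yq: "E q * Y = 1"
    unfolding Y_def using q0 by (metis inverse_mult_eq_1 mult.commute)
  have "E f / E q = E f * Y"
    unfolding Y_def using q0 by (simp add: fps_divide_unit)
  also have "\<dots> = E f * Y * (E u * fps_X ^ n + E v * E q)"
    by (simp add: UV)
  also have "\<dots> = E f * Y * E u * fps_X ^ n + E f * E v * (E q * Y)"
    by (simp add: algebra_simps)
  also have "\<dots> = (E f * Y * E u + E ((f * v) div p)) * fps_X ^ n + E h"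
    by (simp only: Yq h) (simp add: algebra_simps)
  finally have "fps_nth (E f / E q) (n - 1) = fps_nth (E h) (n - 1)"
    using n(1) by (simp add: fps_X_power_mult_right_nth)
  also have "\<dots> = Polynomial.coeff (pcompose (poly_ac h) [:a, 1:]) (n - 1)"
    by (simp add: E_def expand_at_def)
  also have "\<dots> = Polynomial.coeff (poly_ac h) (n - 1)"
  proof (cases "Polynomial.degree h = n - 1")
    case True
    then show ?thesis
      using lead_coeff_comp[of "[:a, 1:]" "poly_ac h"] by (simp add: degree_pcompose degree_poly_ac)
  next
    case False
    then have "Polynomial.degree h < n - 1"
      using degree_mod_less_deg[OF n(2,1), of "f * v"] by (simp add: h_def)
    then show ?thesis by (simp add: coeff_eq_0 degree_pcompose degree_poly_ac)
  qed
  finally show ?thesis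
    by (simp add: L2_ac_def E_def coeff_map_poly h_def)
qed

lemma to_ac_L1:
  fixes p q :: "'a::field poly"
  assumes "n \<ge> 1" "Polynomial.degree p = n" "no_common_root p q"
    and "inj_on lam {1..n}" "poly_ac p = (\<Prod>k=1..n. [:- lam k, 1:])"
  shows "to_ac (L1 n lam p q f) = L1_ac n lam p q f"
proof -
  from assms have "p \<noteq> 0" by auto
  then obtain u v where "u * p + v * q = 1"
    using no_common_root_bezout assms(3) by blast
  then show ?thesis
    unfolding L1_def using L1_ac_eq[OF assms(1,2,4,5)] by simp
qed

lemma to_ac_L2:
  fixes p q :: "'a::field poly"
  assumes "n \<ge> 1" "Polynomial.degree p = n" "no_common_root p q"
    and "poly_ac p = [:- a, 1:] ^ n"
  shows "to_ac (L2 n a C q f) = L2_ac n a C q f"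
proof -
  from assms have "p \<noteq> 0" by auto
  then obtain u v where "u * p + v * q = 1"
    using no_common_root_bezout assms(3) by blast
  then show ?thesis
    unfolding L2_def by (simp only: L2_ac_eq[OF assms(1,2,4)] of_ac_to_ac)
qed

lemma L1_linear:
  fixes p q :: "'a::field poly"
  assumes "n \<ge> 1" "Polynomial.degree p = n" "no_common_root p q"
    and "inj_on lam {1..n}" "poly_ac p = (\<Prod>k=1..n. [:- lam k, 1:])"
  shows "L1 n lam p q (f + g) = L1 n lam p q f + L1 n lam p q g"
    and "L1 n lam p q (Polynomial.smult c f) = c * L1 n lam p q f"
proof -
  have "to_ac (L1 n lam p q (f + g)) = to_ac (L1 n lam p q f + L1 n lam p q g)"
    by (simp add: to_ac_L1[OF assms] L1_ac_def poly_ac_add add_divide_distrib sum.distrib)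
  then show "L1 n lam p q (f + g) = L1 n lam p q f + L1 n lam p q g"
    by (simp only: to_ac_eq_iff)
  have "to_ac (L1 n lam p q (Polynomial.smult c f)) = to_ac (c * L1 n lam p q f)"
    by (simp add: to_ac_L1[OF assms] L1_ac_def poly_ac_smult sum_distrib_left)
  then show "L1 n lam p q (Polynomial.smult c f) = c * L1 n lam p q f"
    by (simp only: to_ac_eq_iff)
qed

lemma L2_linear:
  fixes p q :: "'a::field poly"
  assumes "n \<ge> 1" "Polynomial.degree p = n" "no_common_root p q"
    and "poly_ac p = [:- a, 1:] ^ n"
  shows "L2 n a C q (f + g) = L2 n a C q f + L2 n a C q g"
    and "L2 n a C q (Polynomial.smult c f) = c * L2 n a C q f"
proof -
  from assms have "p \<noteq> 0" by auto
  then obtain u v where "u * p + v * q = 1"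
    using no_common_root_bezout assms(3) by blast
  then have eq: "L2 n a C q h = C * Polynomial.coeff ((h * v) mod p) (n - 1)" for h
    unfolding L2_def by (simp only: L2_ac_eq[OF assms(1,2,4)] of_ac_to_ac)
  show "L2 n a C q (f + g) = L2 n a C q f + L2 n a C q g"
    by (simp add: eq poly_mod_add_left algebra_simps)
  show "L2 n a C q (Polynomial.smult c f) = c * L2 n a C q f"
    by (simp add: eq mod_smult_left)
qed

end

theory Submission
  imports Defs "Jordan_Normal_Form.Determinant"
begin

text \<open>
  Let \<open>u p + v q = 1\<close>. Up to a nonzero factor, both functionals send \<open>f\<close> to the coefficient of
  \<open>t^(n-1)\<close> in \<open>f v mod p\<close>. Hence \<open>L\<close> vanishes on the multiples of \<open>p\<close>, and \<open>L (q f)\<close> is a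
  nonzero multiple of the coefficient of \<open>t^(n-1)\<close> in \<open>f\<close> when \<open>deg f < n\<close>. So the bilinear form
  \<open>(g, f) \<mapsto> L (g f)\<close> makes \<open>p\<close> and \<open>q\<close> the top two members of what would be a family of
  orthogonal polynomials.

  As long as the degrees drop by one, a Euclidean step is the three-term recurrence of orthogonal
  polynomials read downwards, and it passes this property on: a remainder \<open>r\<close> that should have
  degree \<open>d\<close> satisfies \<open>L (r f) = c * coeff f d\<close> for \<open>deg f \<le> d\<close>, with \<open>c \<noteq> 0\<close>
  (lemma \<open>rem_seq_reads_coeff\<close>). On the other side, \<open>H_k\<close> is the Gram matrix of the form on the
  polynomials of degree at most \<open>k\<close>, so it is invertible iff the form is nondegenerate there
  (lemma \<open>invertible_hankel_iff\<close>).

  If the pair is proper, a nonzero \<open>g\<close> in the radical of the form in degree at most \<open>k\<close> is paired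
  nontrivially with the remainder of degree \<open>deg g\<close>, a contradiction. Conversely, if a remainder had
  degree \<open>e\<close> smaller than the expected \<open>d\<close>, it would be nonzero and orthogonal to all polynomials of
  degree at most \<open>e\<close>, so \<open>H_e\<close> would be singular.
\<close>

section \<open>Hankel matrices as Gram matrices\<close>

lemma invertible_mat_iff_det:
  fixes A :: "'a::field mat"
  assumes A: "A \<in> carrier_mat n n"
  shows "invertible_mat A \<longleftrightarrow> det A \<noteq> 0"
proof
  assume "invertible_mat A"
  then obtain B where AB: "A * B = 1\<^sub>m n" and BA: "B * A = 1\<^sub>m (dim_row B)"
    using A unfolding invertible_mat_def inverts_mat_def by auto
  have "dim_row B = dim_col (B * A)" unfolding BA by simp
  moreover have "dim_col B = dim_col (A * B)" by simp
  ultimately have B: "B \<in> carrier_mat n n" using A unfolding AB by auto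
  show "det A \<noteq> 0" using arg_cong[OF AB, of det] by (auto simp: det_mult[OF A B])
next
  assume "det A \<noteq> 0"
  from det_non_zero_imp_unit[OF A this, of "()"]
  show "invertible_mat A"
    using A unfolding Units_def ring_mat_def invertible_mat_def inverts_mat_def by auto
qed

locale linear_functional =
  fixes L :: "'a::field poly \<Rightarrow> 'a"
  assumes add: "L (f + g) = L f + L g"
    and smult: "L (Polynomial.smult c f) = c * L f"
begin

lemma zero: "L 0 = 0"
  using smult[of 0 0] by simp

lemma diff: "L (f - g) = L f - L g"
  using add[of "f - g" g] by simp

lemma sum: "L (sum h A) = (\<Sum>i\<in>A. L (h i))"
  by (induction A rule: infinite_finite_induct) (simp_all add: zero add)

lemma mult_monom_sum:
  assumes "Polynomial.degree g \<le> k"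
  shows "L (g * f) = (\<Sum>i\<le>k. Polynomial.coeff g i * L (Polynomial.monom 1 i * f))"
proof -
  have "g = (\<Sum>i\<le>k. Polynomial.smult (Polynomial.coeff g i) (Polynomial.monom 1 i))"
    using poly_as_sum_of_monoms'[OF assms] by (simp add: smult_monom)
  then have "g * f = (\<Sum>i\<le>k. Polynomial.smult (Polynomial.coeff g i) (Polynomial.monom 1 i * f))"
    by (metis (no_types, lifting) mult_smult_left sum.cong sum_distrib_right)
  then show ?thesis by (simp add: sum smult)
qed

text \<open>
  The product of the Hankel matrix with the coefficient vector of \<open>g\<close> lists the values
  \<open>L (t^i g)\<close>, so a kernel vector is the same as an element of the radical of the form.
\<close>

lemma hankel_mult_vec_nth:
  assumes "Polynomial.degree g \<le> k" "i \<le> k"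
  shows "(hankel L k *\<^sub>v vec (k + 1) (Polynomial.coeff g)) $ i = L (g * Polynomial.monom 1 i)"
proof -
  have "(hankel L k *\<^sub>v vec (k + 1) (Polynomial.coeff g)) $ i
      = (\<Sum>j\<in>{0..<k + 1}. moment L (i + j) * Polynomial.coeff g j)"
    using assms(2) by (simp add: hankel_def scalar_prod_def)
  also have "\<dots> = (\<Sum>j\<le>k. moment L (i + j) * Polynomial.coeff g j)"
    by (rule sum.cong) auto
  also have "\<dots> = L (g * Polynomial.monom 1 i)"
    by (simp add: mult_monom_sum[OF assms(1)] moment_def mult_monom ac_simps)
  finally show ?thesis .
qed

lemma invertible_hankel_iff:
  "invertible_mat (hankel L k) \<longleftrightarrow>
     (\<forall>g. Polynomial.degree g \<le> k \<longrightarrow> (\<forall>f. Polynomial.degree f \<le> k \<longrightarrow> L (g * f) = 0) \<longrightarrow> g = 0)"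
proof -
  have H: "hankel L k \<in> carrier_mat (k + 1) (k + 1)" by (simp add: hankel_def)
  have radical: "(\<forall>f. Polynomial.degree f \<le> k \<longrightarrow> L (g * f) = 0) \<longleftrightarrow>
      hankel L k *\<^sub>v vec (k + 1) (Polynomial.coeff g) = 0\<^sub>v (k + 1)" (is "?rad \<longleftrightarrow> ?ker")
    if g: "Polynomial.degree g \<le> k" for g
  proof
    assume ?rad
    then show ?ker
      using hankel_mult_vec_nth[OF g] H
      by (intro eq_vecI) (auto simp: degree_monom_eq)
  next
    assume ker: ?ker
    have "L (g * Polynomial.monom 1 i) = 0" if "i \<le> k" for i
      using hankel_mult_vec_nth[OF g that] ker that by simp
    then show ?rad
      using mult_monom_sum[of _ k g] by (simp add: mult.commute)
  qed
  have "invertible_mat (hankel L k) \<longleftrightarrow> det (hankel L k) \<noteq> 0"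
    by (rule invertible_mat_iff_det[OF H])
  also have "\<dots> \<longleftrightarrow> (\<forall>x\<in>carrier_vec (k + 1). hankel L k *\<^sub>v x = 0\<^sub>v (k + 1) \<longrightarrow> x = 0\<^sub>v (k + 1))"
    using det_0_iff_vec_prod_zero_field[OF H] by blast
  also have "\<dots> \<longleftrightarrow> (\<forall>g. Polynomial.degree g \<le> k \<longrightarrow>
      hankel L k *\<^sub>v vec (k + 1) (Polynomial.coeff g) = 0\<^sub>v (k + 1) \<longrightarrow> g = 0)"
    (is "?vec \<longleftrightarrow> ?poly")
  proof
    assume ?vec
    show ?poly
    proof (intro allI impI)
      fix g :: "'a poly"
      assume g: "Polynomial.degree g \<le> k"
        and ker: "hankel L k *\<^sub>v vec (k + 1) (Polynomial.coeff g) = 0\<^sub>v (k + 1)"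
      have "vec (k + 1) (Polynomial.coeff g) = 0\<^sub>v (k + 1)"
        using \<open>?vec\<close> ker by simp
      then have "Polynomial.coeff g i = 0" if "i \<le> k" for i
        using that by (metis index_vec index_zero_vec(1) less_Suc_eq_le Suc_eq_plus1)
      then show "g = 0"
        using g by (metis leading_coeff_0_iff)
    qed
  next
    assume ?poly
    show ?vec
    proof (intro ballI impI)
      fix x :: "'a vec"
      assume x: "x \<in> carrier_vec (k + 1)" and ker: "hankel L k *\<^sub>v x = 0\<^sub>v (k + 1)"
      define g where "g = (\<Sum>i\<le>k. Polynomial.monom (x $ i) i)"
      have coeff: "Polynomial.coeff g i = (if i \<le> k then x $ i else 0)" for i
        by (simp add: g_def coeff_sum)
      have deg: "Polynomial.degree g \<le> k"
        by (rule degree_le) (simp add: coeff)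
      have "x = vec (k + 1) (Polynomial.coeff g)"
        using x by (intro eq_vecI) (auto simp: coeff)
      moreover from this ker deg \<open>?poly\<close> have "g = 0" by simp
      ultimately show "x = 0\<^sub>v (k + 1)" by (auto simp: zero_vec_def)
    qed
  qed
  finally show ?thesis using radical by blast
qed

section \<open>Remainders as orthogonal polynomials\<close>

text \<open>
  This is orthogonality of \<open>r\<close> to all polynomials of degree below \<open>d\<close>, together with the value
  \<open>c\<close> of \<open>L (r t^d)\<close>, in a form that is convenient for evaluating \<open>L\<close> on products.
\<close>

definition reads_coeff :: "'a poly \<Rightarrow> nat \<Rightarrow> 'a \<Rightarrow> bool" where
  "reads_coeff r d c \<longleftrightarrow> (\<forall>f. Polynomial.degree f \<le> d \<longrightarrow> L (r * f) = c * Polynomial.coeff f d)"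

text \<open>
  Write the remainder as \<open>A - s B\<close> with \<open>s\<close> linear. The term \<open>A\<close> contributes nothing, and \<open>B\<close> reads
  the coefficient of \<open>t^d\<close> in \<open>s f\<close>, which is the leading coefficient of \<open>s\<close> times the coefficient
  of \<open>t^(d-1)\<close> in \<open>f\<close>.
\<close>

lemma reads_coeff_mod:
  assumes A: "Polynomial.degree A = Suc (Suc d)"
      "\<And>f. Polynomial.degree f \<le> Suc d \<Longrightarrow> L (A * f) = 0"
    and B: "Polynomial.degree B = Suc d" "reads_coeff B (Suc d) c" and "c \<noteq> 0"
  shows "\<exists>c'. c' \<noteq> 0 \<and> reads_coeff (A mod B) d c'"
proof -
  define s where "s = A div B"
  have s: "Polynomial.degree s = 1"
  proof -
    have "Polynomial.degree (A mod B) < Suc d \<or> A mod B = 0"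
      using degree_mod_less[of B A] B(1) by fastforce
    then have small: "Polynomial.degree (A mod B) < Polynomial.degree A"
      using A(1) by auto
    have "A = s * B + A mod B" by (simp add: s_def)
    then have "Polynomial.degree (s * B) = Suc (Suc d)"
      using degree_add_eq_left[of "- (A mod B)" A] small A(1)
      by (metis add_diff_cancel_right' degree_minus diff_conv_add_uminus)
    moreover from this have "s \<noteq> 0" "B \<noteq> 0" by auto
    ultimately show ?thesis using B(1) by (simp add: degree_mult_eq)
  qed
  have "L (A mod B * f) = - c * Polynomial.coeff s 1 * Polynomial.coeff f d"
    if f: "Polynomial.degree f \<le> d" for f
  proof -
    have "A mod B * f = A * f - B * (s * f)"
      by (simp add: s_def minus_div_mult_eq_mod[symmetric] algebra_simps)
    moreover have "Polynomial.degree (s * f) \<le> Suc d"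
      using degree_mult_le[of s f] s f by simp
    moreover have "Polynomial.coeff (s * f) (Suc d) = Polynomial.coeff s 1 * Polynomial.coeff f d"
    proof (cases "Polynomial.degree f = d")
      case True
      then show ?thesis using coeff_mult_degree_sum[of s f] s by simp
    next
      case False
      then have "Polynomial.degree (s * f) < Suc d"
        using degree_mult_le[of s f] s f by simp
      then show ?thesis using False f by (simp add: coeff_eq_0)
    qed
    ultimately show ?thesis
      using A(2)[of f] B(2) f by (simp add: diff reads_coeff_def)
  qed
  moreover have "Polynomial.coeff s 1 \<noteq> 0"
    using s by (metis leading_coeff_0_iff degree_0 zero_neq_one)
  ultimately show ?thesis
    unfolding reads_coeff_def using \<open>c \<noteq> 0\<close>
    by (intro exI[of _ "- c * Polynomial.coeff s 1"]) simp
qed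

text \<open>
  The conclusion is about \<open>rem_seq p q (Suc i)\<close> while the degrees are prescribed only up to index
  \<open>i\<close>, because in the step from invertible Hankel matrices to a proper pair the degree of that
  remainder is derived from what it reads. The induction also carries that the preceding remainder
  annihilates all polynomials of degree at most \<open>n - Suc i\<close>, which is what \<open>reads_coeff_mod\<close>
  asks of \<open>A\<close>; for \<open>i = 0\<close> this is the vanishing of \<open>L\<close> on multiples of \<open>p\<close>.
\<close>

lemma rem_seq_reads_coeff:
  assumes p: "\<And>f. L (p * f) = 0" and q: "reads_coeff q (n - 1) c" "c \<noteq> 0"
    and "i < n" and "\<And>j. j \<le> i \<Longrightarrow> Polynomial.degree (rem_seq p q j) = n - j"
  shows "\<exists>c. c \<noteq> 0 \<and> reads_coeff (rem_seq p q (Suc i)) (n - Suc i) c"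
proof -
  have "(\<exists>c. c \<noteq> 0 \<and> reads_coeff (rem_seq p q (Suc i)) (n - Suc i) c) \<and>
      (\<forall>f. Polynomial.degree f \<le> n - Suc i \<longrightarrow> L (rem_seq p q i * f) = 0)"
    using assms(4,5)
  proof (induction i)
    case 0
    then show ?case using p q by auto
  next
    case (Suc i)
    define d where "d = n - Suc (Suc i)"
    have d: "n - i = Suc (Suc d)" "n - Suc i = Suc d"
      using Suc.prems(1) by (simp_all add: d_def)
    from Suc obtain c where c: "c \<noteq> 0" "reads_coeff (rem_seq p q (Suc i)) (Suc d) c"
      and orth: "\<And>f. Polynomial.degree f \<le> Suc d \<Longrightarrow> L (rem_seq p q i * f) = 0"
      by (auto simp: d)
    have "\<exists>c'. c' \<noteq> 0 \<and> reads_coeff (rem_seq p q i mod rem_seq p q (Suc i)) d c'"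
      using Suc.prems(2)[of i] Suc.prems(2)[of "Suc i"] c orth
      by (intro reads_coeff_mod[where c = c]) (simp_all add: d)
    moreover have "L (rem_seq p q (Suc i) * f) = 0" if "Polynomial.degree f \<le> d" for f
      using c(2) that by (simp add: reads_coeff_def coeff_eq_0)
    ultimately show ?case by (simp add: d_def)
  qed
  then show ?thesis by blast
qed

lemma rem_seq_degrees_iff_hankel:
  assumes n: "n \<ge> 1" "Polynomial.degree p = n" "Polynomial.degree q = n - 1"
    and p: "\<And>f. L (p * f) = 0" and q: "reads_coeff q (n - 1) c" "c \<noteq> 0"
  shows "(\<forall>i<n. rem_seq p q (i + 1) \<noteq> 0 \<and> Polynomial.degree (rem_seq p q (i + 1)) = n - 1 - i)
    \<longleftrightarrow> (\<forall>k<n. invertible_mat (hankel L k))"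
proof
  assume proper: "\<forall>i<n. rem_seq p q (i + 1) \<noteq> 0 \<and>
    Polynomial.degree (rem_seq p q (i + 1)) = n - 1 - i"
  have deg: "Polynomial.degree (rem_seq p q j) = n - j" if "j \<le> n" for j
    using proper n(2) that by (cases j) auto
  show "\<forall>k<n. invertible_mat (hankel L k)"
  proof (unfold invertible_hankel_iff, intro allI impI)
    fix k g
    assume k: "k < n" and g: "Polynomial.degree g \<le> k"
      and rad: "\<forall>f. Polynomial.degree f \<le> k \<longrightarrow> L (g * f) = 0"
    define e where "e = Polynomial.degree g"
    define i where "i = n - Suc e"
    \<comment> \<open>This is the index for which \<open>rem_seq p q (Suc i)\<close> has degree \<open>e\<close>.\<close>
    have i: "i < n" "n - Suc i = e" using g k by (auto simp: i_def e_def)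
    obtain c where c: "c \<noteq> 0" "reads_coeff (rem_seq p q (Suc i)) e c"
      using rem_seq_reads_coeff[OF p q i(1)] deg i by auto
    have "L (g * rem_seq p q (Suc i)) = 0"
      using rad deg[of "Suc i"] i g by (simp add: e_def)
    then have "c * Polynomial.coeff g e = 0"
      using c(2) by (simp add: reads_coeff_def mult.commute e_def)
    then show "g = 0" using c(1) by (simp add: e_def)
  qed
next
  assume hankel: "\<forall>k<n. invertible_mat (hankel L k)"
  have nonzero_deg: "rem_seq p q (Suc i) \<noteq> 0 \<and> Polynomial.degree (rem_seq p q (Suc i)) = n - Suc i"
    if "i < n" for i
    using that
  proof (induction i rule: less_induct)
    case (less i)
    define R where "R = rem_seq p q (Suc i)"
    have deg: "Polynomial.degree (rem_seq p q j) = n - j" if "j \<le> i" for j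
      using less.IH[of "j - 1"] less.prems that n(2) by (cases j) auto
    obtain c where c: "c \<noteq> 0" "reads_coeff R (n - Suc i) c"
      using rem_seq_reads_coeff[OF p q less.prems deg] by (auto simp: R_def)
    have "L (R * Polynomial.monom 1 (n - Suc i)) = c"
      using c(2) by (simp add: reads_coeff_def degree_monom_eq)
    then have nz: "R \<noteq> 0" using c(1) zero by auto
    have "Polynomial.degree R \<le> n - Suc i"
    proof (cases i)
      case 0
      then show ?thesis using n(3) by (simp add: R_def)
    next
      case (Suc j)
      have "rem_seq p q i \<noteq> 0" using less Suc by simp
      then have "Polynomial.degree R < Polynomial.degree (rem_seq p q i)"
        using degree_mod_less[of "rem_seq p q i" "rem_seq p q j"] nz Suc by (auto simp: R_def)
      then show ?thesis using deg[of i] by simp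
    qed
    moreover have "\<not> Polynomial.degree R < n - Suc i"
    proof
      assume small: "Polynomial.degree R < n - Suc i"
      \<comment> \<open>Then \<open>R\<close> lies in the radical of the form on the polynomials of degree at most \<open>deg R\<close>.\<close>
      have "L (R * f) = 0" if "Polynomial.degree f \<le> Polynomial.degree R" for f
        using c(2) that small by (simp add: reads_coeff_def coeff_eq_0)
      then show False
        using hankel small nz unfolding invertible_hankel_iff
        by (meson diff_le_self less_le_trans order_refl)
    qed
    ultimately show ?case using nz by (simp add: R_def)
  qed
  then show "\<forall>i<n. rem_seq p q (i + 1) \<noteq> 0 \<and>
    Polynomial.degree (rem_seq p q (i + 1)) = n - 1 - i"
    by simp
qed

end

section \<open>The functionals of simple roots and of a single root\<close>

theorem theorem8:
  fixes n :: nat and p q :: "'a::field poly" and L :: "'a poly \<Rightarrow> 'a"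
  assumes "n \<ge> 1"
    and "Polynomial.lead_coeff p = 1" and "Polynomial.degree p = n"
    and "Polynomial.lead_coeff q = 1" and "Polynomial.degree q = n - 1"
    and "no_common_root p q"
    and "(\<exists>lam. inj_on lam {1..n} \<and> poly_ac p = (\<Prod>k=1..n. [:- lam k, 1:]) \<and> L = L1 n lam p q) \<or>
         (\<exists>a C. C \<noteq> 0 \<and> poly_ac p = [:- a, 1:] ^ n \<and> L = L2 n a C q)"
  shows "proper_pair n p q \<longleftrightarrow> (\<forall>k<n. invertible_mat (hankel L k))"
proof -
  have "p \<noteq> 0" using assms(1,3) by auto
  then obtain u v where uv: "u * p + v * q = 1"
    using no_common_root_bezout assms(6) by blast
  obtain C where C: "C \<noteq> 0" and L: "L f = C * Polynomial.coeff ((f * v) mod p) (n - 1)" for f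
    using assms(7)
  proof (elim disjE exE conjE)
    fix lam
    assume lam: "inj_on lam {1..n}" "poly_ac p = (\<Prod>k=1..n. [:- lam k, 1:])"
      and "L = L1 n lam p q"
    then have "L f = Polynomial.coeff ((f * v) mod p) (n - 1)" for f
      by (simp only: L1_def L1_ac_eq[OF assms(1,3) lam uv] of_ac_to_ac)
    then show thesis using that[of 1] by simp
  next
    fix a C
    assume "C \<noteq> 0" and a: "poly_ac p = [:- a, 1:] ^ n" and "L = L2 n a C q"
    then have "L f = C * Polynomial.coeff ((f * v) mod p) (n - 1)" for f
      by (simp only: L2_def L2_ac_eq[OF assms(1,3) a uv] of_ac_to_ac)
    then show thesis using that \<open>C \<noteq> 0\<close> by blast
  qed
  interpret linear_functional L
    by unfold_locales (simp_all add: L poly_mod_add_left mod_smult_left algebra_simps)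
  have p: "L (p * f) = 0" for f
    by (simp add: L mult.assoc)
  \<comment> \<open>Since \<open>v\<close> inverts \<open>q\<close> modulo \<open>p\<close>, the product \<open>q f v\<close> reduces to \<open>f\<close> itself.\<close>
  have q: "reads_coeff q (n - 1) C"
    unfolding reads_coeff_def
  proof (intro allI impI)
    fix f :: "'a poly"
    assume "Polynomial.degree f \<le> n - 1"
    then have "f mod p = f" using assms(1,3) by (intro mod_poly_less) simp
    have "q * f * v = f * (u * p + v * q) - u * f * p" by (simp add: algebra_simps)
    then have "q * f * v = f - u * f * p" by (simp add: uv)
    then have "(q * f * v) mod p = f"
      using \<open>f mod p = f\<close> by (simp add: poly_mod_diff_left)
    then show "L (q * f) = C * Polynomial.coeff f (n - 1)" by (simp add: L)
  qed
  show ?thesis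
    using rem_seq_degrees_iff_hankel[OF assms(1,3,5) p q C] assms(2-5)
    by (simp add: proper_pair_def)
qed

end
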